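(* Let $F:\mathbb{R}^n\to\mathbb{R}^m$ and $g:\mathbb{R}^m\to\overline{\mathbb{R}}$, let $f:=g\circ F$, and let $\overline{x}\in\operatorname{dom} f$. Suppose that $F$ is $C^1$ with constant rank near $\overline{x}$ (i.e. $F$ is $C^1$ and the rank of $dF_x$ is constant for $x$ in a neighborhood of $\overline{x}$) and that $g$ is lower semicontinuous near $F(\overline{x})$. Then for all sufficiently small neighborhoods $U$ of $\overline{x}$ the following holds: if $g+\delta_{F(U)}$ has growth exponent $\beta$ (respectively, Kurdyka-Łojasiewicz exponent $\beta$) at $F(\overline{x})$, then $f$ has growth exponent $\beta$ (respectively, Kurdyka-Łojasiewicz exponent $\beta$) at $\overline{x}$.
   Context: $\overline{\mathbb{R}}:=\mathbb{R}\cup\{\infty\}$; $\operatorname{dom} f:=\{x: f(x)<\infty\}$; $d(x,S):=\inf\{|x-y|:y\in S\}$ (with $\inf\emptyset=\infty$), $|\cdot|$ the Euclidean norm; $t_+:=\max\{t,0\}$; $[f\le \ell]:=\{x: f(x)\le \ell\}$, and similarly for other relations; $B_r(x)$ is the ball of radius $r$ centered at $x$; $\delta_C$ is the indicator function of $C$ ($0$ on $C$, $\infty$ elsewhere). Subdifferentials of $f:\mathbb{R}^n\to\overline{\mathbb{R}}$ at $\overline{x}\in\operatorname{dom} f$: $\widehat\partial f(\overline{x}):=\{v: f(x)\ge f(\overline{x})+\langle v,x-\overline{x}\rangle+o(|x-\overline{x}|)\text{ near }\overline{x}\}$; $\partial f(\overline{x})$ is the set of $v$ for which there are $x_k$ and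 $v_k\in\widehat\partial f(x_k)$ with $(x_k,f(x_k),v_k)\to(\overline{x},f(\overline{x}),v)$; $\partial^\infty f(\overline{x})$ is the set of $v$ for which there are $x_k$, $v_k\in\widehat\partial f(x_k)$ and $\tau_k\downarrow 0$ with $(x_k,f(x_k),\tau_kv_k)\to(\overline{x},f(\overline{x}),v)$; the Clarke subdifferential is $\overline\partial f(\overline{x}):=\overline{\mathrm{co}}[\partial f(\overline{x})+\partial^\infty f(\overline{x})]$ (closed convex hull). Growth exponent: $f$ has growth exponent $\beta\in[1,\infty)$ at $\overline{x}\in\operatorname{dom} f$ if there exist $\rho,\kappa>0$ such that $(f(x)-f(\overline{x}))_+\ge\kappa\, d(x,[f\le f(\overline{x})])^\beta$ for all $x\in B_\rho(\overline{x})$. Kurdyka-Łojasiewicz (KŁ) exponent: $f$ has KŁ exponent $\alpha\in[0,1)$ at $\overline{x}\in\operatorname{dom} f$ if there exist $r,\ell,c>0$ such that $d(0,\overline\partial f(x))\ge c(f(x)-f(\overline{x}))^\alpha$ for all $x\in B_r(\overline{x})$ with $0<f(x)-f(\overline{x})<\ell$. *)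

theory Defs
  imports
    "HOL-Analysis.Analysis"
    "HOL-Library.Landau_Symbols"
begin

text \<open>
  Functions with values in the reals extended by \<open>\<infinity>\<close> are rendered as \<^typ>\<open>ereal\<close>-valued
  functions; the definitions below are meant for functions that never take the value \<open>-\<infinity>\<close>.
\<close>

definition edom :: "('a \<Rightarrow> ereal) \<Rightarrow> 'a set" where
  "edom f = {x. f x < \<infinity>}"

definition indicator_fn :: "'a set \<Rightarrow> 'a \<Rightarrow> ereal" where
  "indicator_fn C x = (if x \<in> C then 0 else \<infinity>)"

text \<open>The library's \<^const>\<open>infdist\<close> is \<open>0\<close> for the empty set; here the infimum is \<open>\<infinity>\<close>.\<close>

definition edist_set :: "'a::metric_space \<Rightarrow> 'a set \<Rightarrow> ereal" where
  "edist_set x S = (if S = {} then \<infinity> else ereal (infdist x S))"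

definition lsc_at :: "('a::topological_space \<Rightarrow> ereal) \<Rightarrow> 'a \<Rightarrow> bool" where
  "lsc_at f x \<longleftrightarrow> f x \<le> Liminf (at x) f"

definition lsc_near :: "('a::topological_space \<Rightarrow> ereal) \<Rightarrow> 'a \<Rightarrow> bool" where
  "lsc_near f x \<longleftrightarrow> (\<forall>\<^sub>F y in nhds x. lsc_at f y)"

definition C1_constant_rank_near ::
  "('a::euclidean_space \<Rightarrow> 'b::euclidean_space) \<Rightarrow> 'a \<Rightarrow> bool" where
  "C1_constant_rank_near F x \<longleftrightarrow>
     (\<exists>(F' :: 'a \<Rightarrow> 'a \<Rightarrow>\<^sub>L 'b) V r. open V \<and> x \<in> V \<and>
        (\<forall>y\<in>V. (F has_derivative blinfun_apply (F' y)) (at y)) \<and>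
        continuous_on V F' \<and>
        (\<forall>y\<in>V. dim (range (blinfun_apply (F' y))) = r))"

text \<open>
  All three sets below are empty outside the domain. For the regular subdifferential this has to be
  imposed: otherwise, every vector would qualify at a point near which \<open>f\<close> is identically \<open>\<infinity>\<close>.
\<close>

definition regular_subdiff :: "('a::euclidean_space \<Rightarrow> ereal) \<Rightarrow> 'a \<Rightarrow> 'a set" where
  "regular_subdiff f x = {v. x \<in> edom f \<and>
     (\<exists>h \<in> o[at x](\<lambda>y. norm (y - x)).
        \<forall>\<^sub>F y in at x. f y \<ge> f x + ereal (v \<bullet> (y - x) + h y))}"

definition limiting_subdiff :: "('a::euclidean_space \<Rightarrow> ereal) \<Rightarrow> 'a \<Rightarrow> 'a set" where
  "limiting_subdiff f x = {v. x \<in> edom f \<and>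
     (\<exists>X V. (\<forall>k::nat. V k \<in> regular_subdiff f (X k)) \<and>
        X \<longlonglongrightarrow> x \<and> (\<lambda>k. f (X k)) \<longlonglongrightarrow> f x \<and> V \<longlonglongrightarrow> v)}"

definition horizon_subdiff :: "('a::euclidean_space \<Rightarrow> ereal) \<Rightarrow> 'a \<Rightarrow> 'a set" where
  "horizon_subdiff f x = {v. x \<in> edom f \<and>
     (\<exists>X V (\<tau> :: nat \<Rightarrow> real). (\<forall>k. V k \<in> regular_subdiff f (X k)) \<and>
        (\<forall>k. \<tau> k > 0) \<and> \<tau> \<longlonglongrightarrow> 0 \<and>
        X \<longlonglongrightarrow> x \<and> (\<lambda>k. f (X k)) \<longlonglongrightarrow> f x \<and> (\<lambda>k. \<tau> k *\<^sub>R V k) \<longlonglongrightarrow> v)}"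

definition clarke_subdiff :: "('a::euclidean_space \<Rightarrow> ereal) \<Rightarrow> 'a \<Rightarrow> 'a set" where
  "clarke_subdiff f x =
     closure (convex hull {v + w |v w. v \<in> limiting_subdiff f x \<and> w \<in> horizon_subdiff f x})"

text \<open>
  The sublevel set in the next definition contains \<open>x\<close>, so \<^const>\<open>infdist\<close> is the actual infimum.
\<close>

definition has_growth_exponent ::
  "('a::euclidean_space \<Rightarrow> ereal) \<Rightarrow> real \<Rightarrow> 'a \<Rightarrow> bool" where
  "has_growth_exponent f \<beta> x \<longleftrightarrow> x \<in> edom f \<and> 1 \<le> \<beta> \<and>
     (\<exists>\<rho>>0. \<exists>\<kappa>>0. \<forall>y \<in> ball x \<rho>.
        max (f y - f x) 0 \<ge> ereal (\<kappa> * infdist y {z. f z \<le> f x} powr \<beta>))"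

text \<open>
  In the next definition \<open>f y - f x\<close> is only considered when it is finite and positive, so that
  its passage to the reals loses nothing (and its power with exponent \<open>0\<close> is \<open>1\<close>).
\<close>

definition has_KL_exponent ::
  "('a::euclidean_space \<Rightarrow> ereal) \<Rightarrow> real \<Rightarrow> 'a \<Rightarrow> bool" where
  "has_KL_exponent f \<alpha> x \<longleftrightarrow> x \<in> edom f \<and> 0 \<le> \<alpha> \<and> \<alpha> < 1 \<and>
     (\<exists>r>0. \<exists>l>0. \<exists>c>0. \<forall>y \<in> ball x r.
        0 < f y - f x \<and> f y - f x < ereal l \<longrightarrow>
        edist_set 0 (clarke_subdiff f y) \<ge> ereal (c * real_of_ereal (f y - f x) powr \<alpha>))"

end

theory Submission
  imports Defs
begin

text \<open>
  Write \<open>h\<close> for \<open>g\<close> plus the indicator function of \<open>F ` U\<close>. Near \<open>xbar\<close> we have \<open>f = h \<circ> F\<close>, so both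
  claims ask to transport information about \<open>h\<close> on the image of \<open>F\<close> back along \<open>F\<close>. The tool is a
  family of local sections: by constant rank there is a ball around \<open>xbar\<close> such that for all \<open>x\<close> in it
  there is a map \<open>s x\<close>, differentiable at \<open>F x\<close> with \<open>s x (F x) = x\<close>, that sends every \<open>z\<close> in the image
  of the ball to a preimage of \<open>z\<close> within distance \<open>K * norm (z - F x)\<close> of \<open>x\<close>
  (\<open>constant_rank_local_sections\<close>). Neither \<open>K\<close> nor the ball depends on \<open>x\<close>, \<open>z\<close> or \<open>U\<close>, and the
  derivative \<open>S x\<close> of \<open>s x\<close> at \<open>F x\<close> is continuous in \<open>x\<close> and bounded by \<open>K\<close>.

  For the growth exponent, every point of \<open>[h \<le> h (F xbar)]\<close> lies in \<open>F ` U\<close> and is lifted by \<open>s x\<close> to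
  \<open>[f \<le> f xbar]\<close>. Hence \<open>d(x, [f \<le> f xbar]) \<le> K d(F x, [h \<le> h (F xbar)])\<close>, and the growth inequality
  of \<open>h\<close> at \<open>F x\<close> becomes one of \<open>f\<close> at \<open>x\<close> (\<open>growth_exponent_of_Lipschitz_lifting\<close>).

  For the KL exponent, \<open>f \<circ> s x \<le> h\<close> with equality at \<open>F x\<close>, so the adjoint of \<open>S x\<close> maps regular
  subgradients of \<open>f\<close> at \<open>x\<close> to regular subgradients of \<open>h\<close> at \<open>F x\<close> (\<open>regular_subdiff_pullback\<close>). By
  continuity of \<open>S\<close> the same holds for limiting and horizon subgradients, and by linearity for the
  Clarke subdifferential (\<open>clarke_subdiff_pullback\<close>). Thus \<open>d(0, \<partial>h (F x)) \<le> K d(0, \<partial>f x)\<close> for the Clarke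
  subdifferentials, which transfers the KL inequality (\<open>KL_exponent_of_clarke_subdiff_lifting\<close>).
\<close>

section \<open>Linear algebra of constant rank\<close>

text \<open>
  Compose a right inverse of \<open>L\<close> on its range with a linear projection onto that range. Then \<open>T \<circ> L\<close>
  is a linear projection with the kernel of \<open>L\<close>, which replaces the splitting of the domain into
  \<open>ker L\<close> and a complement.
\<close>

lemma generalized_inverse_exists:
  fixes L :: "'a::euclidean_space \<Rightarrow> 'b::euclidean_space"
  assumes "linear L"
  obtains T where "linear T" "\<And>x. L (T (L x)) = L x" "\<And>y. T (L (T y)) = T y"
proof -
  obtain R where R: "linear R" "\<And>y. y \<in> range L \<Longrightarrow> L (R y) = y"
    using linear_exists_right_inverse_on[OF assms subspace_UNIV] by auto
  obtain P where P: "linear P" "\<And>y. P y \<in> range L" "\<And>y. y \<in> range L \<Longrightarrow> P y = y"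
    using linear_exists_left_inverse_on[OF linear_id linear_subspace_image[OF assms subspace_UNIV]]
    by (auto simp: image_subset_iff)
  show thesis
  proof
    show "linear (R \<circ> P)" by (rule linear_compose[OF P(1) R(1)])
  qed (auto simp: R P)
qed

lemma inj_on_of_dim_image_eq:
  fixes T :: "'a::euclidean_space \<Rightarrow> 'b::euclidean_space"
  assumes T: "linear T" and S: "subspace S" and dim: "dim (T ` S) = dim S"
  shows "inj_on T S"
proof -
  obtain R where R: "linear R" "range R \<subseteq> S" "\<And>y. y \<in> T ` S \<Longrightarrow> T (R y) = y"
    using linear_exists_right_inverse_on[OF T S] by auto
  have TS: "subspace (T ` S)" by (rule linear_subspace_image[OF T S])
  have inj: "inj_on R (span (T ` S))"
    by (metis R(3) TS inj_on_inverseI span_eq_iff)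
  have "dim (R ` T ` S) = dim S"
    using dim_image_eq[OF R(1) inj] dim by simp
  moreover have "subspace (R ` T ` S)" by (rule linear_subspace_image[OF R(1) TS])
  ultimately have "R ` T ` S = S"
    using R(2) by (intro subspace_dim_equal S) auto
  then show ?thesis
    by (metis (no_types, lifting) R(3) imageE inj_on_def)
qed

text \<open>
  The only use of constant rank. Because \<open>T \<circ> A = T \<circ> L \<circ> B\<close> with \<open>B\<close> onto, \<open>T\<close> maps the range of \<open>A\<close>
  onto the range of \<open>T \<circ> L\<close>, whose dimension is the rank of \<open>L\<close>; since \<open>A\<close> has the same rank, \<open>T\<close> is
  injective on the range of \<open>A\<close>, and \<open>T (A u) = 0\<close> forces \<open>A u = 0\<close>. With \<open>L\<close> the derivative of \<open>F\<close>
  at the base point, \<open>A\<close> the derivative at a nearby point and \<open>B\<close> the derivative of the straightening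
  diffeomorphism, this says that \<open>F\<close> does not vary to first order along its would-be fibres.
\<close>

lemma constant_rank_kernel:
  fixes L A :: "'a::euclidean_space \<Rightarrow> 'b::euclidean_space"
  assumes L: "linear L" and T: "linear T" and A: "linear A"
    and LTL: "\<And>x. L (T (L x)) = L x"
    and rank: "dim (range A) = dim (range L)"
    and TA: "\<And>u. T (A u) = T (L (B u))" and B: "surj B"
    and ker: "T (L (B u)) = 0"
  shows "A u = 0"
proof -
  have "inj_on T (span (range L))"
    by (metis L LTL inj_on_inverseI linear_subspace_image rangeE span_eq_iff subspace_UNIV)
  then have "dim (T ` range L) = dim (range A)"
    by (simp add: dim_image_eq[OF T] rank)
  moreover have "T ` range A = T ` range L"
    using B by (auto simp: TA image_iff surj_def) metis
  ultimately have "inj_on T (range A)"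
    by (intro inj_on_of_dim_image_eq[OF T] linear_subspace_image[OF A] subspace_UNIV) auto
  moreover have "T (A u) = T (A 0)"
    using ker TA by (simp add: linear_0[OF A] linear_0[OF T])
  ultimately show ?thesis
    using linear_0[OF A] by (metis inj_on_eq_iff rangeI)
qed

lemma constant_on_segment_of_zero_derivative:
  fixes G :: "'a::euclidean_space \<Rightarrow> 'b::euclidean_space"
  assumes W: "convex W" "a \<in> W" "b \<in> W"
    and G: "\<And>q. q \<in> W \<Longrightarrow> (G has_derivative G' q) (at q)"
    and zero: "\<And>q. q \<in> W \<Longrightarrow> G' q (b - a) = 0"
  shows "G a = G b"
proof -
  have in_W: "a + t *\<^sub>R (b - a) \<in> W" if "t \<in> {0..1}" for t
    using that convexD_alt[OF W, of t] by (simp add: algebra_simps)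
  have "((\<lambda>t. G (a + t *\<^sub>R (b - a))) has_vector_derivative 0) (at t within {0..1})"
    if t: "t \<in> {0..1}" for t
  proof -
    have "((\<lambda>t. G (a + t *\<^sub>R (b - a))) has_derivative
        (\<lambda>h. G' (a + t *\<^sub>R (b - a)) (h *\<^sub>R (b - a)))) (at t within {0..1})"
      by (rule has_derivative_compose[where f = "\<lambda>t. a + t *\<^sub>R (b - a)" and g = G and f' = "\<lambda>h. h *\<^sub>R (b - a)", OF _ G[OF in_W[OF t]]])
        (auto intro!: derivative_eq_intros)
    moreover have "G' (a + t *\<^sub>R (b - a)) (h *\<^sub>R (b - a)) = 0" for h
      using zero[OF in_W[OF t]] has_derivative_linear[OF G[OF in_W[OF t]]]
      by (simp add: linear_cmul)
    ultimately show ?thesis by (simp add: has_vector_derivative_def)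
  qed
  then obtain c where c: "\<And>t. t \<in> {0..1} \<Longrightarrow> G (a + t *\<^sub>R (b - a)) = c"
    using has_vector_derivative_zero_constant[of "{0..1::real}" "\<lambda>t. G (a + t *\<^sub>R (b - a))"]
    by auto
  show ?thesis using c[of 0] c[of 1] by simp
qed

section \<open>Local sections of maps of constant rank\<close>

text \<open>
  The form of the constant rank theorem used below. With \<open>T\<close> a generalized inverse of the derivative
  \<open>L\<close> of \<open>F\<close> at \<open>x0\<close>, the map \<open>\<Phi> x = x + T (F x) - T (L x)\<close> has derivative the identity at \<open>x0\<close>, hence
  a local inverse \<open>\<Psi>\<close>, and \<open>T \<circ> F = T \<circ> L \<circ> \<Phi>\<close>. By constant rank \<open>F \<circ> \<Psi>\<close> is constant along the
  directions in \<open>ker L\<close>, so it depends on \<open>T (L q)\<close> only. Moving \<open>\<Phi> x\<close> by \<open>T (z - F x)\<close> gives it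
  the same \<open>T \<circ> L\<close> part as any \<open>\<Phi> x'\<close> with \<open>F x' = z\<close>, and therefore \<open>s x z = \<Psi> (\<Phi> x + T (z - F x))\<close>
  is mapped to \<open>z\<close> by \<open>F\<close>.

  Away from the image of \<open>F\<close>, the values of \<open>s x\<close> are not preimages; they are there so that \<open>s x\<close> has a
  derivative at \<open>F x\<close> in the ordinary sense. One ball serves for the base points and for the points that are lifted; this
  uniformity is what makes arbitrary neighbourhoods inside the ball admissible later.
\<close>

lemma constant_rank_local_sections:
  fixes F :: "'a::euclidean_space \<Rightarrow> 'b::euclidean_space"
  assumes "C1_constant_rank_near F x0"
  obtains \<epsilon> K s S where "\<epsilon> > 0" "K > 0" "continuous_on (ball x0 \<epsilon>) F"
    "\<And>x x'. x \<in> ball x0 \<epsilon> \<Longrightarrow> x' \<in> ball x0 \<epsilon> \<Longrightarrow> F (s x (F x')) = F x'"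
    "\<And>x x'. x \<in> ball x0 \<epsilon> \<Longrightarrow> x' \<in> ball x0 \<epsilon> \<Longrightarrow> norm (s x (F x') - x) \<le> K * norm (F x' - F x)"
    "\<And>x. x \<in> ball x0 \<epsilon> \<Longrightarrow> (s x has_derivative S x) (at (F x))"
    "\<And>x u. x \<in> ball x0 \<epsilon> \<Longrightarrow> norm (S x u) \<le> K * norm u"
    "\<And>u. continuous_on (ball x0 \<epsilon>) (\<lambda>x. S x u)"
proof -
  obtain F' :: "'a \<Rightarrow> 'a \<Rightarrow>\<^sub>L 'b" and V r where V: "open V" "x0 \<in> V"
    and F': "\<And>y. y \<in> V \<Longrightarrow> (F has_derivative F' y) (at y)"
    and F'_cont: "continuous_on V F'"
    and rank: "\<And>y. y \<in> V \<Longrightarrow> dim (range (F' y)) = r"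
    using assms unfolding C1_constant_rank_near_def by blast
  define L where "L = F' x0"
  have linear_blinfun: "linear (blinfun_apply A)" for A :: "'c::euclidean_space \<Rightarrow>\<^sub>L 'd::euclidean_space"
    by (rule bounded_linear.linear[OF blinfun.bounded_linear_right])
  obtain T0 where "linear T0" "\<And>x. L (T0 (L x)) = L x" "\<And>y. T0 (L (T0 y)) = T0 y"
    using generalized_inverse_exists[OF linear_blinfun[of L]] by blast
  then obtain T :: "'b \<Rightarrow>\<^sub>L 'a" where LTL: "\<And>x. L (T (L x)) = L x" and TLT: "\<And>y. T (L (T y)) = T y"
    by (metis bounded_linear_Blinfun_apply linear_conv_bounded_linear)
  define \<Phi> where "\<Phi> x = x + T (F x) - T (L x)" for x
  define \<Phi>' where "\<Phi>' x = id_blinfun + (T o\<^sub>L F' x) - (T o\<^sub>L L)" for x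
  have \<Phi>'_apply: "\<Phi>' x u = u + T (F' x u) - T (L u)" for x u
    by (simp add: \<Phi>'_def blinfun.add_left blinfun.diff_left)
  have \<Phi>'_x0: "\<Phi>' x0 = id_blinfun"
    by (simp add: \<Phi>'_def L_def)
  have \<Phi>'_cont: "continuous_on V \<Phi>'"
    unfolding \<Phi>'_def by (intro continuous_intros F'_cont)
  have \<Phi>_deriv: "(\<Phi> has_derivative \<Phi>' x) (at x)" if "x \<in> V" for x
  proof -
    have "(\<Phi> has_derivative (\<lambda>u. u + T (F' x u) - T (L u))) (at x)"
      unfolding \<Phi>_def
      by (intro has_derivative_add has_derivative_diff has_derivative_ident
          bounded_linear.has_derivative[OF blinfun.bounded_linear_right] F' that)
    then show ?thesis by (simp add: \<Phi>'_apply[abs_def])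
  qed
  have TF: "T (F x) = T (L (\<Phi> x))" for x
    by (simp add: \<Phi>_def blinfun.add_right blinfun.diff_right LTL TLT)
  have TF': "T (F' x u) = T (L (\<Phi>' x u))" for x u
    by (simp add: \<Phi>'_apply blinfun.add_right blinfun.diff_right LTL TLT)

  \<comment> \<open>Where \<open>\<Phi>'\<close> is within \<open>1/2\<close> of the identity, \<open>\<Phi>\<close> and \<open>\<Phi>'\<close> shrink lengths by a factor of at most \<open>2\<close>;
    this gives the Lipschitz bound for \<open>\<Psi>\<close> and the continuity of the inverse derivative.\<close>
  obtain \<delta> where \<delta>: "\<delta> > 0" "ball x0 \<delta> \<subseteq> V"
    and near_id: "\<And>x. x \<in> ball x0 \<delta> \<Longrightarrow> norm (\<Phi>' x - id_blinfun) \<le> 1/2"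
  proof -
    obtain d where "d > 0" and d: "\<And>x. x \<in> V \<Longrightarrow> dist x x0 < d \<Longrightarrow> dist (\<Phi>' x) (\<Phi>' x0) < 1/2"
      using \<Phi>'_cont[unfolded continuous_on_iff, rule_format, of x0 "1/2"] V(2) by auto
    obtain e where "e > 0" "ball x0 e \<subseteq> V" using V by (meson openE)
    show thesis
    proof
      show "min d e > 0" using \<open>d > 0\<close> \<open>e > 0\<close> by simp
      show "ball x0 (min d e) \<subseteq> V" using \<open>ball x0 e \<subseteq> V\<close> by auto
      then show "norm (\<Phi>' x - id_blinfun) \<le> 1/2" if "x \<in> ball x0 (min d e)" for x
        using d[of x] that by (auto simp: dist_norm \<Phi>'_x0 dist_commute norm_minus_commute subset_iff)
    qed
  qed
  have \<Phi>'_lower: "norm u \<le> 2 * norm (\<Phi>' x u)" if "x \<in> ball x0 \<delta>" for x u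
  proof -
    have "norm (\<Phi>' x u - u) \<le> 1/2 * norm u"
      using norm_blinfun[of "\<Phi>' x - id_blinfun" u] mult_right_mono[OF near_id[OF that] norm_ge_zero[of u]]
      by (simp add: blinfun.diff_left)
    then show ?thesis using norm_triangle_ineq2[of u "\<Phi>' x u"] by (simp add: norm_minus_commute)
  qed
  have \<Phi>_lower: "norm (x - x') \<le> 2 * norm (\<Phi> x - \<Phi> x')"
    if "x \<in> ball x0 \<delta>" "x' \<in> ball x0 \<delta>" for x x'
  proof -
    have "norm ((\<Phi> x - x) - (\<Phi> x' - x')) \<le> 1/2 * norm (x - x')"
    proof (rule differentiable_bound[of "ball x0 \<delta>" "\<lambda>x. \<Phi> x - x" "\<lambda>x. blinfun_apply (\<Phi>' x - id_blinfun)"])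
      show "((\<lambda>x. \<Phi> x - x) has_derivative (\<Phi>' x - id_blinfun)) (at x within ball x0 \<delta>)"
        if "x \<in> ball x0 \<delta>" for x
      proof -
        have "((\<lambda>x. \<Phi> x - x) has_derivative (\<lambda>u. \<Phi>' x u - u)) (at x within ball x0 \<delta>)"
          using that \<delta> by (intro has_derivative_diff has_derivative_ident
            has_derivative_at_withinI[OF \<Phi>_deriv]) auto
        then show ?thesis by (simp add: blinfun.diff_left[abs_def])
      qed
      show "onorm (\<Phi>' x - id_blinfun) \<le> 1/2" if "x \<in> ball x0 \<delta>" for x
        using near_id[OF that] by (simp add: norm_blinfun.rep_eq)
    qed (use that in auto)
    then have "norm ((x - x') - (\<Phi> x - \<Phi> x')) \<le> 1/2 * norm (x - x')"
      by (metis (no_types, lifting) add_diff_eq diff_add_eq diff_diff_eq2 norm_minus_commute)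
    then show ?thesis using norm_triangle_ineq2[of "x - x'" "\<Phi> x - \<Phi> x'"] by simp
  qed

  obtain W V' \<Psi> \<Psi>' where W: "open W" "W \<subseteq> ball x0 \<delta>" "x0 \<in> W" and V': "open V'" "\<Phi> x0 \<in> V'"
    and hom: "homeomorphism W V' \<Phi> \<Psi>"
    and \<Psi>_deriv: "\<And>y. y \<in> V' \<Longrightarrow> (\<Psi> has_derivative \<Psi>' y) (at y)"
    and \<Psi>': "\<And>y. y \<in> V' \<Longrightarrow> \<Psi>' y = inv (\<Phi>' (\<Psi> y))"
    and bij: "\<And>y. y \<in> V' \<Longrightarrow> bij (\<Phi>' (\<Psi> y))"
  proof (rule inverse_function_theorem[of "ball x0 \<delta>" \<Phi> \<Phi>' x0 id_blinfun])
    show "continuous_on (ball x0 \<delta>) \<Phi>'" by (rule continuous_on_subset[OF \<Phi>'_cont \<delta>(2)])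
    show "id_blinfun o\<^sub>L \<Phi>' x0 = id_blinfun"
      by (simp add: \<Phi>'_x0 blinfun_eqI)
  qed (use \<delta> \<Phi>_deriv in auto)
  have \<Psi>_in: "\<Psi> q \<in> W" and \<Phi>\<Psi>: "\<Phi> (\<Psi> q) = q" if "q \<in> V'" for q
    using hom that by (auto simp: homeomorphism_def)
  have \<Psi>\<Phi>: "\<Psi> (\<Phi> x) = x" and \<Phi>_in: "\<Phi> x \<in> V'" if "x \<in> W" for x
    using hom that by (auto simp: homeomorphism_def)
  have \<Phi>'\<Psi>': "\<Phi>' (\<Psi> q) (\<Psi>' q u) = u" if "q \<in> V'" for q u
    using bij[OF that] by (simp add: \<Psi>'[OF that] bij_is_surj surj_f_inv_f)
  have \<Psi>_Lipschitz: "norm (\<Psi> q - \<Psi> q') \<le> 2 * norm (q - q')" if "q \<in> V'" "q' \<in> V'" for q q'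
    using \<Phi>_lower[of "\<Psi> q" "\<Psi> q'"] subsetD[OF W(2) \<Psi>_in] that by (simp add: \<Phi>\<Psi>)

  obtain \<rho> where \<rho>: "\<rho> > 0" "ball (\<Phi> x0) \<rho> \<subseteq> V'" using V' by (meson openE)
  have fibres: "F (\<Psi> a) = F (\<Psi> b)"
    if ab: "a \<in> ball (\<Phi> x0) \<rho>" "b \<in> ball (\<Phi> x0) \<rho>" and TL: "T (L a) = T (L b)" for a b
  proof (rule constant_on_segment_of_zero_derivative[of "ball (\<Phi> x0) \<rho>" a b "\<lambda>q. F (\<Psi> q)"
        "\<lambda>q u. F' (\<Psi> q) (\<Psi>' q u)"])
    fix q assume "q \<in> ball (\<Phi> x0) \<rho>"
    then have q: "q \<in> V'" using \<rho> by auto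
    then have \<Psi>q: "\<Psi> q \<in> V" using \<Psi>_in W \<delta> by blast
    show "((\<lambda>q. F (\<Psi> q)) has_derivative (\<lambda>u. F' (\<Psi> q) (\<Psi>' q u))) (at q)"
      by (rule has_derivative_compose[OF \<Psi>_deriv[OF q] F'[OF \<Psi>q]])
    show "F' (\<Psi> q) (\<Psi>' q (b - a)) = 0"
    proof (rule constant_rank_kernel[of L T "F' (\<Psi> q)" "\<Phi>' (\<Psi> q)"])
      show "dim (range (F' (\<Psi> q))) = dim (range L)"
        using rank \<Psi>q V(2) by (simp add: L_def)
      show "surj (\<Phi>' (\<Psi> q))" by (rule bij_is_surj[OF bij[OF q]])
      show "T (L (\<Phi>' (\<Psi> q) (\<Psi>' q (b - a)))) = 0"
        by (simp add: \<Phi>'\<Psi>'[OF q] blinfun.diff_right TL)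
    qed (auto simp: linear_blinfun LTL TF')
  qed (use ab in auto)

  define s where "s x z = \<Psi> (\<Phi> x + T (z - F x))" for x z
  define S where "S x u = \<Psi>' (\<Phi> x) (T u)" for x u
  have F_cont: "continuous_on V F"
    by (meson F' continuous_at_imp_continuous_on has_derivative_continuous)
  have \<Phi>_cont: "continuous_on V \<Phi>"
    by (meson \<Phi>_deriv continuous_at_imp_continuous_on has_derivative_continuous)
  have "continuous_on V (\<lambda>x. T (F x))"
    by (intro continuous_intros F_cont)
  \<comment> \<open>The shift by \<open>T (F x' - F x)\<close> is shorter than \<open>\<rho>/4 + \<rho>/4\<close>; starting within \<open>\<rho>/2\<close> of
    \<open>\<Phi> x0\<close> it stays in the ball of radius \<open>\<rho>\<close>.\<close>
  obtain \<epsilon> where \<epsilon>: "\<epsilon> > 0" "ball x0 \<epsilon> \<subseteq> W"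
    and \<Phi>_near: "\<And>x. x \<in> ball x0 \<epsilon> \<Longrightarrow> dist (\<Phi> x0) (\<Phi> x) < \<rho> / 2"
    and TF_near: "\<And>x. x \<in> ball x0 \<epsilon> \<Longrightarrow> dist (T (F x0)) (T (F x)) < \<rho> / 4"
  proof -
    have cont: "isCont \<Phi> x0" "isCont (\<lambda>x. T (F x)) x0"
      using \<Phi>_cont \<open>continuous_on V (\<lambda>x. T (F x))\<close> V continuous_on_eq_continuous_at by blast+
    have "\<forall>\<^sub>F x in nhds x0. dist (\<Phi> x0) (\<Phi> x) < \<rho> / 2"
      using cont(1)[unfolded continuous_at_eps_delta, rule_format, of "\<rho> / 2"] \<rho>(1)
      by (simp add: eventually_nhds_metric dist_commute)
    moreover have "\<forall>\<^sub>F x in nhds x0. dist (T (F x0)) (T (F x)) < \<rho> / 4"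
      using cont(2)[unfolded continuous_at_eps_delta, rule_format, of "\<rho> / 4"] \<rho>(1)
      by (simp add: eventually_nhds_metric dist_commute)
    moreover have "\<forall>\<^sub>F x in nhds x0. x \<in> W"
      using W by (simp add: eventually_nhds_in_open)
    ultimately have "\<forall>\<^sub>F x in nhds x0. x \<in> W \<and> dist (\<Phi> x0) (\<Phi> x) < \<rho> / 2 \<and> dist (T (F x0)) (T (F x)) < \<rho> / 4"
      by eventually_elim auto
    then show thesis
      using that by (auto simp: eventually_nhds_metric dist_commute subset_iff)
  qed
  have lift_in: "\<Phi> x + T (F x' - F x) \<in> ball (\<Phi> x0) \<rho>"
    if "x \<in> ball x0 \<epsilon>" "x' \<in> ball x0 \<epsilon>" for x x'
  proof -
    have "norm (T (F x' - F x)) < \<rho> / 2"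
      using TF_near[OF that(1)] TF_near[OF that(2)] dist_triangle3[of "T (F x')" "T (F x)" "T (F x0)"]
      by (simp add: blinfun.diff_right dist_norm)
    moreover have "dist (\<Phi> x0) (\<Phi> x + T (F x' - F x)) \<le> dist (\<Phi> x0) (\<Phi> x) + norm (T (F x' - F x))"
      by (metis add_diff_cancel_left' dist_commute dist_norm dist_triangle)
    ultimately show ?thesis using \<Phi>_near[OF that(1)] by simp
  qed
  have in_W: "x \<in> W" "x \<in> V" "x \<in> ball x0 \<delta>" if "x \<in> ball x0 \<epsilon>" for x
    using that \<epsilon> W \<delta> by blast+
  have \<Phi>'_S: "\<Phi>' x (S x u) = T u" if "x \<in> ball x0 \<epsilon>" for x u
    using \<Phi>'\<Psi>'[of "\<Phi> x" "T u"] in_W[OF that] by (simp add: S_def \<Phi>_in \<Psi>\<Phi>)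
  \<comment> \<open>The summand \<open>1\<close> keeps \<open>K\<close> positive when \<open>T = 0\<close>, that is, when \<open>F\<close> has rank zero.\<close>
  define K where "K = 2 * norm T + 1"
  have K: "K > 0" by (simp add: K_def add_nonneg_pos)
  have K_T: "2 * norm (T u) \<le> K * norm u" for u
  proof -
    have "2 * norm (T u) \<le> 2 * (norm T * norm u)" using norm_blinfun[of T u] by simp
    also have "\<dots> \<le> K * norm u" by (simp add: K_def distrib_right mult.assoc)
    finally show ?thesis .
  qed

  show thesis
  proof (rule that[of \<epsilon> K s S])
    show "continuous_on (ball x0 \<epsilon>) F"
      by (rule continuous_on_subset[OF F_cont]) (use in_W in blast)
    fix x x' assume x: "x \<in> ball x0 \<epsilon>" "x' \<in> ball x0 \<epsilon>"
    have "\<Phi> x' \<in> ball (\<Phi> x0) \<rho>" using \<Phi>_near[OF x(2)] \<rho>(1) by simp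
    moreover have "T (L (\<Phi> x + T (F x' - F x))) = T (L (\<Phi> x'))"
      by (simp add: blinfun.add_right blinfun.diff_right TLT flip: TF)
    ultimately have "F (s x (F x')) = F (\<Psi> (\<Phi> x'))"
      unfolding s_def by (intro fibres lift_in x) auto
    then show "F (s x (F x')) = F x'" by (simp add: \<Psi>\<Phi> in_W(1)[OF x(2)])
    have "norm (s x (F x') - \<Psi> (\<Phi> x)) \<le> 2 * norm (T (F x' - F x))"
      unfolding s_def using \<Psi>_Lipschitz[of "\<Phi> x + T (F x' - F x)" "\<Phi> x"] lift_in[OF x] \<rho> in_W[OF x(1)]
      by (auto simp: \<Phi>_in)
    then show "norm (s x (F x') - x) \<le> K * norm (F x' - F x)"
      using K_T[of "F x' - F x"] by (simp add: \<Psi>\<Phi> in_W(1)[OF x(1)])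
  next
    fix x assume x: "x \<in> ball x0 \<epsilon>"
    have "((\<lambda>z. \<Phi> x + T (z - F x)) has_derivative T) (at (F x))"
      by (auto intro!: derivative_eq_intros simp: blinfun.diff_right)
    moreover have "(\<Psi> has_derivative \<Psi>' (\<Phi> x)) (at (\<Phi> x + T (F x - F x)))"
      using \<Psi>_deriv[OF \<Phi>_in[OF in_W(1)[OF x]]] by (simp add: blinfun.zero_right)
    ultimately show "(s x has_derivative S x) (at (F x))"
      unfolding s_def[abs_def] S_def[abs_def] by (rule has_derivative_compose)
    show "norm (S x u) \<le> K * norm u" for u
      using \<Phi>'_lower[OF in_W(3)[OF x], of "S x u"] K_T[of u] by (simp add: \<Phi>'_S[OF x])
  next
    fix u
    show "continuous_on (ball x0 \<epsilon>) (\<lambda>x. S x u)"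
      unfolding continuous_on_def
    proof
      fix y assume y: "y \<in> ball x0 \<epsilon>"
      \<comment> \<open>\<open>\<Phi>' x\<close> maps \<open>S x u - S y u\<close> to \<open>(\<Phi>' y - \<Phi>' x) (S y u)\<close>, because both \<open>S\<close>-terms lift \<open>T u\<close>.\<close>
      have "((\<lambda>x. \<Phi>' x (S y u)) \<longlongrightarrow> \<Phi>' y (S y u)) (at y within ball x0 \<epsilon>)"
        using \<Phi>'_cont y in_W
        by (intro tendsto_intros) (meson continuous_on_def subsetI tendsto_within_subset)
      then have lim: "((\<lambda>x. 2 * norm (\<Phi>' x (S y u) - \<Phi>' y (S y u))) \<longlongrightarrow> 0) (at y within ball x0 \<epsilon>)"
        by (simp add: LIM_zero tendsto_norm_zero tendsto_mult_right_zero)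
      have bound: "\<forall>\<^sub>F x in at y within ball x0 \<epsilon>.
          norm (S x u - S y u) \<le> 2 * norm (\<Phi>' x (S y u) - \<Phi>' y (S y u))"
        unfolding eventually_at_filter
      proof (rule always_eventually, intro allI impI)
        fix x assume "x \<in> ball x0 \<epsilon>"
        then show "norm (S x u - S y u) \<le> 2 * norm (\<Phi>' x (S y u) - \<Phi>' y (S y u))"
          using \<Phi>'_lower[OF in_W(3), of x "S x u - S y u"] \<Phi>'_S y
          by (simp add: blinfun.diff_right norm_minus_commute)
      qed
      show "((\<lambda>x. S x u) \<longlongrightarrow> S y u) (at y within ball x0 \<epsilon>)"
        by (rule LIM_zero_cancel[OF Lim_null_comparison[OF bound lim]])
    qed
  qed (use \<epsilon> K in auto)
qed

section \<open>Pulling back subgradients along sections\<close>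

text \<open>
  The little-o remainder is traded for an \<open>\<epsilon>\<close>-condition, which composes better with other
  first-order expansions.
\<close>

lemma regular_subdiff_iff:
  fixes f :: "'a::euclidean_space \<Rightarrow> ereal"
  assumes f: "\<And>y. f y \<noteq> -\<infinity>"
  shows "v \<in> regular_subdiff f x \<longleftrightarrow> x \<in> edom f \<and>
    (\<forall>e>0. \<forall>\<^sub>F y in at x. f x + ereal (v \<bullet> (y - x) - e * norm (y - x)) \<le> f y)"
    (is "?L \<longleftrightarrow> ?R")
proof
  assume ?L
  then obtain h where x: "x \<in> edom f" and h: "h \<in> o[at x](\<lambda>y. norm (y - x))"
    and le: "\<forall>\<^sub>F y in at x. f x + ereal (v \<bullet> (y - x) + h y) \<le> f y"
    unfolding regular_subdiff_def by blast
  show ?R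
  proof (intro conjI x allI impI)
    fix e :: real assume "e > 0"
    then have "\<forall>\<^sub>F y in at x. norm (h y) \<le> e * norm (norm (y - x))"
      by (rule landau_o.smallD[OF h])
    with le show "\<forall>\<^sub>F y in at x. f x + ereal (v \<bullet> (y - x) - e * norm (y - x)) \<le> f y"
    proof eventually_elim
      case (elim y)
      have "f x + ereal (v \<bullet> (y - x) - e * norm (y - x)) \<le> f x + ereal (v \<bullet> (y - x) + h y)"
        using elim(2) by (intro add_left_mono) auto
      then show ?case using elim(1) by (rule order_trans)
    qed
  qed
next
  assume R: ?R
  then obtain c where c: "f x = ereal c"
    using f[of x] by (cases "f x") (auto simp: edom_def)
  \<comment> \<open>The remainder has to be real: it is minus the amount by which \<open>f\<close> falls below the
    affine function, and \<open>0\<close> where \<open>f\<close> is infinite.\<close>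
  define h where "h y = (if f y = \<infinity> then 0 else min 0 (real_of_ereal (f y) - c - v \<bullet> (y - x)))" for y
  have "h \<in> o[at x](\<lambda>y. norm (y - x))"
  proof (rule landau_o.smallI)
    fix e :: real assume "e > 0"
    with R have "\<forall>\<^sub>F y in at x. f x + ereal (v \<bullet> (y - x) - e * norm (y - x)) \<le> f y" by blast
    then show "\<forall>\<^sub>F y in at x. norm (h y) \<le> e * norm (norm (y - x))"
    proof eventually_elim
      case (elim y)
      then show ?case using \<open>e > 0\<close> f[of y]
        by (cases "f y") (auto simp: h_def c min_def)
    qed
  qed
  moreover have "f x + ereal (v \<bullet> (y - x) + h y) \<le> f y" for y
    using f[of y] by (cases "f y") (auto simp: h_def c min_def)
  ultimately show ?L
    using R unfolding regular_subdiff_def by (blast intro: always_eventually)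
qed

text \<open>
  If \<open>f \<circ> s \<le> h\<close> near \<open>y\<close> with equality at \<open>y\<close>, then a
  first-order minorant of \<open>f\<close> at \<open>s y\<close>, composed with the first-order expansion of \<open>s\<close>, is a
  first-order minorant of \<open>h\<close> at \<open>y\<close>.
\<close>

lemma regular_subdiff_pullback:
  fixes f :: "'a::euclidean_space \<Rightarrow> ereal" and h :: "'b::euclidean_space \<Rightarrow> ereal"
  assumes f: "\<And>x. f x \<noteq> -\<infinity>" and h: "\<And>z. h z \<noteq> -\<infinity>"
    and s: "(s has_derivative S) (at y)"
    and eq: "f (s y) = h y" and le: "\<forall>\<^sub>F z in at y. f (s z) \<le> h z"
    and v: "v \<in> regular_subdiff f (s y)"
  shows "adjoint S v \<in> regular_subdiff h y"
proof -
  have linS: "linear S" by (rule has_derivative_linear[OF s])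
  obtain B where B: "B > 0" "\<And>u. norm (S u) \<le> B * norm u"
    using linear_bounded_pos[OF linS] by blast
  have "y \<in> edom h"
    using v eq by (simp add: regular_subdiff_iff[OF f] edom_def)
  moreover have "\<forall>\<^sub>F z in at y. h y + ereal (adjoint S v \<bullet> (z - y) - e * norm (z - y)) \<le> h z"
    if "e > 0" for e
  proof -
    \<comment> \<open>The error at \<open>z\<close> is at most \<open>norm v * e2 + e1 * (B + 1)\<close> times \<open>norm (z - y)\<close>, where \<open>e1\<close> comes
      from \<open>f\<close> and \<open>e2\<close> from \<open>s\<close>; both summands are made at most \<open>e / 2\<close>.\<close>
    define e1 where "e1 = e / (2 * (B + 1))"
    define e2 where "e2 = min 1 (e / (2 * (norm v + 1)))"
    have e1: "e1 > 0" and e2: "e2 > 0" "e2 \<le> 1"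
      using that B(1) norm_ge_zero[of v] by (auto simp: e1_def e2_def add_nonneg_pos)
    have split: "norm v * e2 + e1 * (B + 1) \<le> e"
    proof -
      have "norm v * e2 \<le> (norm v + 1) * (e / (2 * (norm v + 1)))"
        using that by (intro mult_mono) (auto simp: e2_def)
      also have "\<dots> = e / 2" using norm_ge_zero[of v] by (simp add: field_simps add_nonneg_eq_0_iff)
      finally have "norm v * e2 \<le> e / 2" .
      moreover have "e1 * (B + 1) = e / 2" using B(1) by (simp add: e1_def divide_simps)
      ultimately show ?thesis by simp
    qed
    \<comment> \<open>The inequality is trivial at \<open>x = s y\<close>, which has to be included as \<open>s\<close> may take this value often.\<close>
    have "\<forall>\<^sub>F x in at (s y). f (s y) + ereal (v \<bullet> (x - s y) - e1 * norm (x - s y)) \<le> f x"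
      using v e1 by (simp add: regular_subdiff_iff[OF f])
    then have "\<forall>\<^sub>F x in nhds (s y). f (s y) + ereal (v \<bullet> (x - s y) - e1 * norm (x - s y)) \<le> f x"
      by (simp add: eventually_nhds_conv_at zero_ereal_def[symmetric])
    moreover have "filterlim s (nhds (s y)) (at y)"
      using has_derivative_continuous[OF s] by (simp add: continuous_at)
    ultimately have "\<forall>\<^sub>F z in at y. f (s y) + ereal (v \<bullet> (s z - s y) - e1 * norm (s z - s y)) \<le> f (s z)"
      by (rule eventually_compose_filterlim)
    moreover have "\<forall>\<^sub>F z in at y. norm (s z - s y - S (z - y)) \<le> e2 * norm (z - y)"
      using s e2(1) by (simp add: has_derivative_within_alt2)
    ultimately show ?thesis using le
    proof eventually_elim
      case (elim z)
      let ?d = "s z - s y"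
      have "v \<bullet> (S (z - y) - ?d) \<le> norm v * (e2 * norm (z - y))"
        using norm_cauchy_schwarz[of v "S (z - y) - ?d"] mult_left_mono[OF elim(2) norm_ge_zero[of v]]
        by (simp add: norm_minus_commute)
      moreover have "norm ?d \<le> (B + 1) * norm (z - y)"
      proof -
        have "norm ?d \<le> norm (?d - S (z - y)) + norm (S (z - y))"
          by (metis diff_add_cancel norm_triangle_ineq)
        also have "\<dots> \<le> 1 * norm (z - y) + B * norm (z - y)"
          using elim(2) B(2)[of "z - y"] mult_right_mono[OF e2(2) norm_ge_zero[of "z - y"]] by linarith
        finally show ?thesis by (simp add: algebra_simps)
      qed
      then have "e1 * norm ?d \<le> e1 * ((B + 1) * norm (z - y))"
        using e1 by (intro mult_left_mono) auto
      moreover have "(norm v * e2 + e1 * (B + 1)) * norm (z - y) \<le> e * norm (z - y)"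
        by (rule mult_right_mono[OF split]) simp
      ultimately have "adjoint S v \<bullet> (z - y) - e * norm (z - y) \<le> v \<bullet> ?d - e1 * norm ?d"
        by (simp add: adjoint_clauses[OF linS] linear_diff[OF linS] inner_diff_right algebra_simps)
      then have "h y + ereal (adjoint S v \<bullet> (z - y) - e * norm (z - y)) \<le> f (s y) + ereal (v \<bullet> ?d - e1 * norm ?d)"
        unfolding eq by (intro add_left_mono) simp
      also have "\<dots> \<le> f (s z)" by (rule elim)
      also have "\<dots> \<le> h z" by (rule elim)
      finally show ?case .
    qed
  qed
  ultimately show ?thesis by (simp add: regular_subdiff_iff[OF h])
qed

text \<open>
  Pointwise convergence of the operators is enough: tested against a basis vector, the claim only
  involves the operators at that vector.
\<close>

lemma tendsto_adjoint_apply: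
  fixes S :: "'i \<Rightarrow> 'a::euclidean_space \<Rightarrow> 'b::euclidean_space"
  assumes lin: "\<forall>\<^sub>F i in G. linear (S i)" "linear S0"
    and S: "\<And>u. ((\<lambda>i. S i u) \<longlongrightarrow> S0 u) G" and v: "(v \<longlongrightarrow> v0) G"
  shows "((\<lambda>i. adjoint (S i) (v i)) \<longlongrightarrow> adjoint S0 v0) G"
proof (subst tendsto_componentwise_iff, rule ballI)
  fix b :: 'a
  have "((\<lambda>i. v i \<bullet> S i b) \<longlongrightarrow> v0 \<bullet> S0 b) G"
    by (intro tendsto_intros S v)
  then have "((\<lambda>i. v i \<bullet> S i b) \<longlongrightarrow> adjoint S0 v0 \<bullet> b) G"
    by (simp add: adjoint_clauses[OF lin(2)])
  moreover have "\<forall>\<^sub>F i in G. v i \<bullet> S i b = adjoint (S i) (v i) \<bullet> b"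
    using lin(1) by eventually_elim (simp add: adjoint_clauses)
  ultimately show "((\<lambda>i. adjoint (S i) (v i) \<bullet> b) \<longlongrightarrow> adjoint S0 v0 \<bullet> b) G"
    by (rule Lim_transform_eventually)
qed

lemma norm_adjoint_le:
  fixes S :: "'a::euclidean_space \<Rightarrow> 'b::euclidean_space"
  assumes "linear S" and K: "\<And>u. norm (S u) \<le> K * norm u"
  shows "norm (adjoint S v) \<le> K * norm v"
proof (cases "adjoint S v = 0")
  case True
  have "0 \<le> K * norm v" if "v \<noteq> 0"
    using order_trans[OF norm_ge_zero K[of "SOME b. b \<in> Basis"]] SOME_Basis that
    by simp
  with True show ?thesis by fastforce
next
  case False
  let ?w = "adjoint S v"
  have "norm ?w * norm ?w = ?w \<bullet> ?w"
    by (simp add: dot_square_norm power2_eq_square)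
  also have "\<dots> = v \<bullet> S ?w"
    by (simp add: adjoint_clauses[OF assms(1)] inner_commute)
  also have "\<dots> \<le> norm v * (K * norm ?w)"
    by (rule order_trans[OF norm_cauchy_schwarz]) (intro mult_left_mono K norm_ge_zero)
  finally show ?thesis using False by (simp add: mult_ac)
qed

text \<open>
  The derivative \<open>S x\<close> of the section at \<open>F x\<close> depends continuously on \<open>x\<close>, so its adjoint carries
  sequences of regular subgradients of \<open>f\<close>, scaled or not, to such sequences of \<open>h\<close>, and their
  limits to the limits. Linearity then passes the inclusion on to closed convex hulls.
\<close>

lemma clarke_subdiff_pullback:
  fixes F :: "'a::euclidean_space \<Rightarrow> 'b::euclidean_space"
    and f :: "'a \<Rightarrow> ereal" and h :: "'b \<Rightarrow> ereal"
  assumes f: "\<And>x. f x \<noteq> -\<infinity>" and h: "\<And>z. h z \<noteq> -\<infinity>"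
    and W: "open W" "x \<in> W" and F_cont: "continuous_on W F"
    and fh: "\<And>x. x \<in> W \<Longrightarrow> f x = h (F x)"
    and s: "\<And>x. x \<in> W \<Longrightarrow> (s x has_derivative S x) (at (F x))"
    and sF: "\<And>x. x \<in> W \<Longrightarrow> s x (F x) = x"
    and le: "\<And>x. x \<in> W \<Longrightarrow> \<forall>\<^sub>F z in at (F x). f (s x z) \<le> h z"
    and S_cont: "\<And>u. continuous_on W (\<lambda>x. S x u)"
  shows "adjoint (S x) ` clarke_subdiff f x \<subseteq> clarke_subdiff h (F x)"
proof -
  have linS: "linear (S x)" if "x \<in> W" for x
    by (rule has_derivative_linear[OF s[OF that]])
  have lin_adj: "linear (adjoint (S x))" by (rule adjoint_linear[OF linS[OF W(2)]])

  \<comment> \<open>Limiting and horizon subgradients are handled at once, by \<open>\<tau> = 1\<close> and \<open>\<tau> \<longlonglongrightarrow> 0\<close> respectively. The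
    sequence is shifted by \<open>N\<close> because all its members have to lie in \<open>W\<close>.\<close>
  have sequences: "\<exists>N. (\<forall>k. adjoint (S (X (k + N))) (V (k + N)) \<in> regular_subdiff h (F (X (k + N)))) \<and>
      (\<lambda>k. F (X (k + N))) \<longlonglongrightarrow> F x \<and> (\<lambda>k. h (F (X (k + N)))) \<longlonglongrightarrow> h (F x) \<and>
      (\<lambda>k. \<tau> (k + N) *\<^sub>R adjoint (S (X (k + N))) (V (k + N))) \<longlonglongrightarrow> adjoint (S x) v"
    if V: "\<And>k. V k \<in> regular_subdiff f (X k)" and X: "X \<longlonglongrightarrow> x"
      and fX: "(\<lambda>k. f (X k)) \<longlonglongrightarrow> f x" and \<tau>V: "(\<lambda>k. \<tau> k *\<^sub>R V k) \<longlonglongrightarrow> v"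
    for X V v and \<tau> :: "nat \<Rightarrow> real"
  proof -
    have "\<forall>\<^sub>F k in sequentially. X k \<in> W"
      using topological_tendstoD[OF X W] .
    then obtain N where "\<And>k. X (k + N) \<in> W"
      unfolding eventually_sequentially by (metis le_add2)
    note N = this
    define Y where "Y k = X (k + N)" for k
    have YW: "Y k \<in> W" for k by (simp add: Y_def N)
    have Y: "Y \<longlonglongrightarrow> x" unfolding Y_def by (rule LIMSEQ_ignore_initial_segment[OF X])
    have cont: "(\<lambda>k. G (Y k)) \<longlonglongrightarrow> G x" if "continuous_on W G" for G :: "'a \<Rightarrow> 'd::topological_space"
      using continuous_on_tendsto_compose[OF that Y W(2)] YW by simp
    have "adjoint (S (Y k)) (V (k + N)) \<in> regular_subdiff h (F (Y k))" for k
      using V[of "k + N"]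
      by (intro regular_subdiff_pullback[OF f h s[OF YW] _ le[OF YW]])
        (simp_all add: sF[OF YW] fh[OF YW], simp add: Y_def)
    moreover have "(\<lambda>k. F (Y k)) \<longlonglongrightarrow> F x" by (rule cont[OF F_cont])
    moreover have "(\<lambda>k. h (F (Y k))) \<longlonglongrightarrow> h (F x)"
      using LIMSEQ_ignore_initial_segment[OF fX, of N] fh[OF YW] fh[OF W(2)] by (simp add: Y_def)
    moreover have "(\<lambda>k. \<tau> (k + N) *\<^sub>R adjoint (S (Y k)) (V (k + N))) \<longlonglongrightarrow> adjoint (S x) v"
    proof -
      have "(\<lambda>k. adjoint (S (Y k)) (\<tau> (k + N) *\<^sub>R V (k + N))) \<longlonglongrightarrow> adjoint (S x) v"
        by (rule tendsto_adjoint_apply[OF _ _ _ LIMSEQ_ignore_initial_segment[OF \<tau>V]])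
          (simp_all add: linS YW W cont[OF S_cont])
      then show ?thesis by (simp add: linear_cmul[OF adjoint_linear[OF linS[OF YW]]])
    qed
    ultimately show ?thesis unfolding Y_def by blast
  qed

  have limiting: "adjoint (S x) v \<in> limiting_subdiff h (F x)" if v: "v \<in> limiting_subdiff f x" for v
  proof -
    obtain X V where x: "x \<in> edom f" and V: "\<And>k::nat. V k \<in> regular_subdiff f (X k)"
      and XV: "X \<longlonglongrightarrow> x" "(\<lambda>k. f (X k)) \<longlonglongrightarrow> f x" "V \<longlonglongrightarrow> v"
      using v unfolding limiting_subdiff_def by blast
    have "F x \<in> edom h" using x by (simp add: edom_def fh[OF W(2)])
    moreover obtain N where "\<And>k. adjoint (S (X (k + N))) (V (k + N)) \<in> regular_subdiff h (F (X (k + N)))"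
      and "(\<lambda>k. F (X (k + N))) \<longlonglongrightarrow> F x" "(\<lambda>k. h (F (X (k + N)))) \<longlonglongrightarrow> h (F x)"
      and "(\<lambda>k. adjoint (S (X (k + N))) (V (k + N))) \<longlonglongrightarrow> adjoint (S x) v"
      using sequences[of V X "\<lambda>_. 1" v] V XV by auto
    ultimately show ?thesis
      unfolding limiting_subdiff_def
      by (intro CollectI conjI exI[of _ "\<lambda>k. F (X (k + N))"]
          exI[of _ "\<lambda>k. adjoint (S (X (k + N))) (V (k + N))"]) auto
  qed
  have horizon: "adjoint (S x) v \<in> horizon_subdiff h (F x)" if v: "v \<in> horizon_subdiff f x" for v
  proof -
    obtain X V \<tau> where x: "x \<in> edom f" and V: "\<And>k::nat. V k \<in> regular_subdiff f (X k)"
      and XV: "X \<longlonglongrightarrow> x" "(\<lambda>k. f (X k)) \<longlonglongrightarrow> f x" "(\<lambda>k. \<tau> k *\<^sub>R V k) \<longlonglongrightarrow> v"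
      and \<tau>: "\<And>k. \<tau> k > 0" "\<tau> \<longlonglongrightarrow> 0"
      using v unfolding horizon_subdiff_def by blast
    have "F x \<in> edom h" using x by (simp add: edom_def fh[OF W(2)])
    moreover obtain N where "\<And>k. adjoint (S (X (k + N))) (V (k + N)) \<in> regular_subdiff h (F (X (k + N)))"
      and "(\<lambda>k. F (X (k + N))) \<longlonglongrightarrow> F x" "(\<lambda>k. h (F (X (k + N)))) \<longlonglongrightarrow> h (F x)"
      and "(\<lambda>k. \<tau> (k + N) *\<^sub>R adjoint (S (X (k + N))) (V (k + N))) \<longlonglongrightarrow> adjoint (S x) v"
      using sequences[OF V XV] by blast
    moreover have "(\<lambda>k. \<tau> (k + N)) \<longlonglongrightarrow> 0"
      by (rule LIMSEQ_ignore_initial_segment[OF \<tau>(2)])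
    ultimately show ?thesis
      unfolding horizon_subdiff_def using \<tau>(1)
      by (intro CollectI conjI exI[of _ "\<lambda>k. F (X (k + N))"]
          exI[of _ "\<lambda>k. adjoint (S (X (k + N))) (V (k + N))"] exI[of _ "\<lambda>k. \<tau> (k + N)"]) auto
  qed

  let ?P = "{v + w |v w. v \<in> limiting_subdiff f x \<and> w \<in> horizon_subdiff f x}"
  let ?Q = "{v + w |v w. v \<in> limiting_subdiff h (F x) \<and> w \<in> horizon_subdiff h (F x)}"
  have "adjoint (S x) ` ?P \<subseteq> ?Q"
    using limiting horizon by (fastforce simp: linear_add[OF lin_adj])
  then have "adjoint (S x) ` (convex hull ?P) \<subseteq> convex hull ?Q"
    by (simp add: convex_hull_linear_image[OF lin_adj] hull_mono)
  then show ?thesis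
    unfolding clarke_subdiff_def
    using closure_linear_image_subset[OF lin_adj, of "convex hull ?P"] closure_mono by blast
qed

section \<open>Transfer of the exponents\<close>

text \<open>
  If points of the sublevel set of \<open>h\<close> lift to the sublevel set of \<open>f\<close> with displacement at most \<open>K\<close>
  times the displacement below, then distances to the sublevel sets compare with the factor \<open>K\<close>, and
  the growth constant of \<open>h\<close> is divided by \<open>K powr \<beta>\<close>.
\<close>

lemma growth_exponent_of_Lipschitz_lifting:
  fixes F :: "'a::euclidean_space \<Rightarrow> 'b::euclidean_space"
    and f :: "'a \<Rightarrow> ereal" and h :: "'b \<Rightarrow> ereal"
  assumes W: "open W" "x0 \<in> W" and F_cont: "continuous_on W F"
    and fh: "\<And>x. x \<in> W \<Longrightarrow> f x = h (F x)" and K: "K > 0"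
    and lift: "\<And>x z. x \<in> W \<Longrightarrow> h z \<le> h (F x0) \<Longrightarrow> \<exists>x'. f x' \<le> f x0 \<and> dist x' x \<le> K * dist z (F x)"
    and growth: "has_growth_exponent h \<beta> (F x0)"
  shows "has_growth_exponent f \<beta> x0"
proof -
  from growth obtain \<rho> \<kappa> where dom: "F x0 \<in> edom h" and \<beta>: "1 \<le> \<beta>" and \<rho>: "\<rho> > 0" and \<kappa>: "\<kappa> > 0"
    and le: "\<And>y. y \<in> ball (F x0) \<rho> \<Longrightarrow>
      ereal (\<kappa> * infdist y {z. h z \<le> h (F x0)} powr \<beta>) \<le> max (h y - h (F x0)) 0"
    unfolding has_growth_exponent_def by blast
  have "open (W \<inter> F -` ball (F x0) \<rho>)"
    by (rule continuous_open_preimage[OF F_cont W(1)]) simp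
  moreover have "x0 \<in> W \<inter> F -` ball (F x0) \<rho>"
    using W(2) \<rho> by simp
  ultimately obtain r where r: "r > 0" "ball x0 r \<subseteq> W \<inter> F -` ball (F x0) \<rho>"
    by (rule openE)
  have dist: "infdist x {z. f z \<le> f x0} \<le> K * infdist (F x) {z. h z \<le> h (F x0)}" if x: "x \<in> W" for x
  proof -
    have "infdist x {z. f z \<le> f x0} / K \<le> infdist (F x) {z. h z \<le> h (F x0)}"
    proof (subst (2) infdist_notempty)
      show "infdist x {z. f z \<le> f x0} / K \<le> (INF z\<in>{z. h z \<le> h (F x0)}. dist (F x) z)"
      proof (rule cINF_greatest)
        fix z assume "z \<in> {z. h z \<le> h (F x0)}"
        then obtain x' where "f x' \<le> f x0" "dist x' x \<le> K * dist z (F x)"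
          using lift[OF x] by blast
        then have "infdist x {z. f z \<le> f x0} \<le> K * dist z (F x)"
          by (intro infdist_le2[of x']) (auto simp: dist_commute)
        then show "infdist x {z. f z \<le> f x0} / K \<le> dist (F x) z"
          using K by (simp add: field_simps dist_commute)
      qed auto
    qed auto
    then show ?thesis using K by (simp add: field_simps)
  qed
  have "ereal (\<kappa> / K powr \<beta> * infdist x {z. f z \<le> f x0} powr \<beta>) \<le> max (f x - f x0) 0"
    if x: "x \<in> ball x0 r" for x
  proof -
    have xW: "x \<in> W" "F x \<in> ball (F x0) \<rho>" using x r by auto
    have "infdist x {z. f z \<le> f x0} powr \<beta> \<le> (K * infdist (F x) {z. h z \<le> h (F x0)}) powr \<beta>"
      using \<beta> by (intro powr_mono2 dist xW infdist_nonneg) auto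
    also have "\<dots> = K powr \<beta> * infdist (F x) {z. h z \<le> h (F x0)} powr \<beta>"
      using K by (simp add: powr_mult infdist_nonneg)
    finally have "\<kappa> / K powr \<beta> * infdist x {z. f z \<le> f x0} powr \<beta>
        \<le> \<kappa> * infdist (F x) {z. h z \<le> h (F x0)} powr \<beta>"
      using K \<kappa> by (simp add: field_simps)
    then show ?thesis
      using le[OF xW(2)] fh[OF xW(1)] fh[OF W(2)] by (metis ereal_less_eq(3) order_trans)
  qed
  moreover have "x0 \<in> edom f" using dom by (simp add: edom_def fh[OF W(2)])
  moreover have "\<kappa> / K powr \<beta> > 0" using K \<kappa> by simp
  ultimately show ?thesis
    unfolding has_growth_exponent_def using \<beta> r(1) by blast
qed

text \<open>
  If every subgradient of \<open>f\<close> at \<open>x\<close> is matched by one of \<open>h\<close> at \<open>F x\<close> that is at most \<open>K\<close> times as long,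
  then the distances from \<open>0\<close> to the subdifferentials compare with the factor \<open>K\<close>. Where \<open>f\<close> has no
  subgradients its distance is \<open>\<infinity>\<close> and there is nothing to compare.
\<close>

lemma KL_exponent_of_clarke_subdiff_lifting:
  fixes F :: "'a::euclidean_space \<Rightarrow> 'b::euclidean_space"
    and f :: "'a \<Rightarrow> ereal" and h :: "'b \<Rightarrow> ereal"
  assumes W: "open W" "x0 \<in> W" and F_cont: "continuous_on W F"
    and fh: "\<And>x. x \<in> W \<Longrightarrow> f x = h (F x)" and K: "K > 0"
    and lift: "\<And>x v. x \<in> W \<Longrightarrow> v \<in> clarke_subdiff f x \<Longrightarrow>
      \<exists>w\<in>clarke_subdiff h (F x). norm w \<le> K * norm v"
    and KL: "has_KL_exponent h \<alpha> (F x0)"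
  shows "has_KL_exponent f \<alpha> x0"
proof -
  from KL obtain \<rho> l c where dom: "F x0 \<in> edom h" and \<alpha>: "0 \<le> \<alpha>" "\<alpha> < 1"
    and \<rho>: "\<rho> > 0" and l: "l > 0" and c: "c > 0"
    and le: "\<And>y. y \<in> ball (F x0) \<rho> \<Longrightarrow> 0 < h y - h (F x0) \<Longrightarrow> h y - h (F x0) < ereal l \<Longrightarrow>
      ereal (c * real_of_ereal (h y - h (F x0)) powr \<alpha>) \<le> edist_set 0 (clarke_subdiff h y)"
    unfolding has_KL_exponent_def by blast
  have "open (W \<inter> F -` ball (F x0) \<rho>)"
    by (rule continuous_open_preimage[OF F_cont W(1)]) simp
  moreover have "x0 \<in> W \<inter> F -` ball (F x0) \<rho>"
    using W(2) \<rho> by simp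
  ultimately obtain r where r: "r > 0" "ball x0 r \<subseteq> W \<inter> F -` ball (F x0) \<rho>"
    by (rule openE)
  have "ereal (c / K * real_of_ereal (f x - f x0) powr \<alpha>) \<le> edist_set 0 (clarke_subdiff f x)"
    if x: "x \<in> ball x0 r" and gap: "0 < f x - f x0" "f x - f x0 < ereal l" for x
  proof (cases "clarke_subdiff f x = {}")
    case True
    then show ?thesis by (simp add: edist_set_def)
  next
    case False
    have xW: "x \<in> W" "F x \<in> ball (F x0) \<rho>" using x r by auto
    let ?t = "c * real_of_ereal (f x - f x0) powr \<alpha>"
    have t: "ereal ?t \<le> edist_set 0 (clarke_subdiff h (F x))"
      using le[OF xW(2)] gap by (simp add: fh[OF xW(1)] fh[OF W(2)])
    have "?t / K \<le> infdist 0 (clarke_subdiff f x)"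
      unfolding infdist_notempty[OF False]
    proof (rule cINF_greatest[OF False])
      fix v assume "v \<in> clarke_subdiff f x"
      then obtain w where w: "w \<in> clarke_subdiff h (F x)" "norm w \<le> K * norm v"
        using lift[OF xW(1)] by blast
      have "?t \<le> infdist 0 (clarke_subdiff h (F x))"
        using t w(1) by (auto simp: edist_set_def split: if_splits)
      also have "\<dots> \<le> norm w"
        using infdist_le[OF w(1), of 0] by simp
      finally show "?t / K \<le> dist 0 v"
        using w(2) K by (simp add: field_simps)
    qed
    then show ?thesis using False by (simp add: edist_set_def)
  qed
  moreover have "x0 \<in> edom f" using dom by (simp add: edom_def fh[OF W(2)])
  moreover have "c / K > 0" using K c by simp
  ultimately show ?thesis
    unfolding has_KL_exponent_def using \<alpha> r(1) l by blast
qed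

theorem theorem3p6:
  fixes F :: "real ^ 'n \<Rightarrow> real ^ 'm"
    and g :: "real ^ 'm \<Rightarrow> ereal"
    and f :: "real ^ 'n \<Rightarrow> ereal"
    and xbar :: "real ^ 'n"
  assumes g_range: "\<And>y. g y \<noteq> -\<infinity>"
    and f_eq: "f = g \<circ> F"
    and xbar: "xbar \<in> edom f"
    and F: "C1_constant_rank_near F xbar"
    and g_lsc: "lsc_near g (F xbar)"
  shows "\<exists>\<epsilon>>0. \<forall>U. xbar \<in> interior U \<and> U \<subseteq> ball xbar \<epsilon> \<longrightarrow>
    (\<forall>\<beta>.
      (has_growth_exponent (\<lambda>y. g y + indicator_fn (F ` U) y) \<beta> (F xbar) \<longrightarrow>
         has_growth_exponent f \<beta> xbar) \<and>
      (has_KL_exponent (\<lambda>y. g y + indicator_fn (F ` U) y) \<beta> (F xbar) \<longrightarrow>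
         has_KL_exponent f \<beta> xbar))"
proof -
  obtain \<epsilon> K s S where "\<epsilon> > 0" and K: "K > 0" and F_cont: "continuous_on (ball xbar \<epsilon>) F"
    and F_s: "\<And>x x'. x \<in> ball xbar \<epsilon> \<Longrightarrow> x' \<in> ball xbar \<epsilon> \<Longrightarrow> F (s x (F x')) = F x'"
    and s_le: "\<And>x x'. x \<in> ball xbar \<epsilon> \<Longrightarrow> x' \<in> ball xbar \<epsilon> \<Longrightarrow>
      norm (s x (F x') - x) \<le> K * norm (F x' - F x)"
    and s: "\<And>x. x \<in> ball xbar \<epsilon> \<Longrightarrow> (s x has_derivative S x) (at (F x))"
    and S_le: "\<And>x u. x \<in> ball xbar \<epsilon> \<Longrightarrow> norm (S x u) \<le> K * norm u"
    and S_cont: "\<And>u. continuous_on (ball xbar \<epsilon>) (\<lambda>x. S x u)"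
    using constant_rank_local_sections[OF F] by blast
  \<comment> \<open>The radius of the ball from the constant rank theorem works for every \<open>U\<close> and every \<open>\<beta>\<close>.\<close>
  have "(has_growth_exponent (\<lambda>y. g y + indicator_fn (F ` U) y) \<beta> (F xbar) \<longrightarrow>
         has_growth_exponent f \<beta> xbar) \<and>
      (has_KL_exponent (\<lambda>y. g y + indicator_fn (F ` U) y) \<beta> (F xbar) \<longrightarrow>
         has_KL_exponent f \<beta> xbar)"
    if U: "xbar \<in> interior U" "U \<subseteq> ball xbar \<epsilon>" for U \<beta>
  proof -
    define h where "h y = g y + indicator_fn (F ` U) y" for y
    let ?W = "interior U"
    have h_in: "h z = g z" if "z \<in> F ` U" for z using that by (simp add: h_def indicator_fn_def)
    have h_out: "h z = \<infinity>" if "z \<notin> F ` U" for z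
      using that g_range[of z] by (simp add: h_def indicator_fn_def)
    have W_ball: "x \<in> ball xbar \<epsilon>" if "x \<in> ?W" for x
      using that U(2) interior_subset by blast
    have fh: "f x = h (F x)" if "x \<in> ?W" for x
      using that interior_subset[of U] h_in[of "F x"] by (auto simp: f_eq)
    have F_cont': "continuous_on ?W F"
      by (rule continuous_on_subset[OF F_cont]) (use W_ball in blast)
    have S_cont': "continuous_on ?W (\<lambda>x. S x u)" for u
      by (rule continuous_on_subset[OF S_cont]) (use W_ball in blast)
    have S_cont': "continuous_on ?W (\<lambda>x. S x u)" for u
      by (rule continuous_on_subset[OF S_cont]) (use W_ball in blast)
    \<comment> \<open>Equality on \<open>F ` U\<close>, where \<open>s x\<close> is a section of \<open>F\<close>; elsewhere the right-hand side is \<open>\<infinity>\<close>.\<close>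
    have f_s: "f (s x z) \<le> h z" if x: "x \<in> ?W" for x z
    proof (cases "z \<in> F ` U")
      case True
      then show ?thesis
        using F_s[OF W_ball[OF x]] U(2) by (auto simp: f_eq h_in)
    qed (simp add: h_out)
    have sF: "s x (F x) = x" if "x \<in> ?W" for x
      using s_le[OF W_ball[OF that] W_ball[OF that]] by simp
    have "has_growth_exponent f \<beta> xbar" if "has_growth_exponent h \<beta> (F xbar)"
    proof (rule growth_exponent_of_Lipschitz_lifting[OF open_interior U(1) F_cont' fh K _ that])
      fix x z assume x: "x \<in> ?W" and z: "h z \<le> h (F xbar)"
      have "h z < \<infinity>"
        by (rule order_le_less_trans[OF z]) (use xbar fh[OF U(1)] in \<open>simp add: edom_def\<close>)
      then have "z \<in> F ` U" using h_out by fastforce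
      then have "dist (s x z) x \<le> K * dist z (F x)"
        using s_le[OF W_ball[OF x]] U(2) by (auto simp: dist_norm)
      moreover have "f (s x z) \<le> f xbar"
        using f_s[OF x, of z] z fh[OF U(1)] by simp
      ultimately show "\<exists>x'. f x' \<le> f xbar \<and> dist x' x \<le> K * dist z (F x)" by blast
    qed
    moreover have "has_KL_exponent f \<beta> xbar" if "has_KL_exponent h \<beta> (F xbar)"
    proof (rule KL_exponent_of_clarke_subdiff_lifting[OF open_interior U(1) F_cont' fh K _ that])
      fix x v assume x: "x \<in> ?W" and v: "v \<in> clarke_subdiff f x"
      have "f y \<noteq> -\<infinity>" "h z \<noteq> -\<infinity>" for y z
        using g_range by (auto simp: f_eq h_def indicator_fn_def)
      then have "adjoint (S x) ` clarke_subdiff f x \<subseteq> clarke_subdiff h (F x)"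
        by (rule clarke_subdiff_pullback[where s = s and W = ?W])
          (use x F_cont' fh s W_ball sF f_s S_cont' in auto)
      moreover have "norm (adjoint (S x) v) \<le> K * norm v"
        using W_ball[OF x] by (intro norm_adjoint_le has_derivative_linear[OF s] S_le)
      ultimately show "\<exists>w\<in>clarke_subdiff h (F x). norm w \<le> K * norm v"
        using v by blast
    qed
    ultimately show ?thesis unfolding h_def by blast
  qed
  then show ?thesis using \<open>\<epsilon> > 0\<close> by blast
qed

end
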